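(* Let $(X,d)$ be a complete separable metric space in which closed balls are compact, and let $\alpha:\mathbb{R}^+\to\mathbb{R}^+$ be an increasing convex function of class $\mathcal{C}^1$ with $\alpha(0)=0$. Let $f:X\to\mathbb{R}$ be an upper semicontinuous function bounded from above, and for $t>0$, $x\in X$ put $$P_tf(x)=\sup_{y\in X}\left\{f(y)-t\,\alpha\left(\frac{d(x,y)}{t}\right)\right\}.$$ Then $$\frac{d}{dt_+}P_tf(x)\ \geq\ \alpha^*\left(|\nabla^+P_tf|(x)\right)\qquad\forall t>0,\ \forall x\in X,$$ and $$\frac{d}{dt_-}P_tf(x)\ \geq\ \alpha^*\left(|\nabla^-P_tf|(x)\right)\qquad\forall t>0,\ \forall x\in X.$$ Moreover, when $(X,d)$ is geodesic, $$\frac{d}{dt_+}P_tf(x)\ =\ \alpha^*\left(|\nabla^+P_tf|(x)\right)\qquad\forall t>0,\ \forall x\in X.$$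
   Context: $\frac{d}{dt_+}$ and $\frac{d}{dt_-}$ denote respectively the right and left derivatives in $t$. The function $\alpha^*$ is $\alpha^*(u)=\sup_{h\ge 0}\{hu-\alpha(h)\}$, $u\ge0$. For $g:X\to\mathbb{R}$ and $x\in X$, $$|\nabla^+g|(x)=\limsup_{y\to x}\frac{[g(y)-g(x)]_+}{d(x,y)},\qquad |\nabla^-g|(x)=\limsup_{y\to x}\frac{[g(y)-g(x)]_-}{d(x,y)},$$ where $[\cdot]_+$, $[\cdot]_-$ are the positive and negative parts, the limsup is over $y\ne x$, and $|\nabla^\pm g|(x)=0$ by convention if $x$ is an isolated point. $(X,d)$ is geodesic if for all $x,y\in X$ there is a curve $(\gamma_t)_{t\in[0,1]}$ with $\gamma_0=x$, $\gamma_1=y$ and $d(\gamma_s,\gamma_t)=|t-s|\,d(x,y)$ for all $s,t\in[0,1]$. *)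

theory Defs
  imports "HOL-Analysis.Analysis"
begin

definition upper_semicontinuous :: "('a::topological_space \<Rightarrow> real) \<Rightarrow> bool" where
  "upper_semicontinuous f \<longleftrightarrow> (\<forall>x. \<forall>c > f x. \<forall>\<^sub>F y in nhds x. f y < c)"

definition geodesic_space :: "'a::metric_space itself \<Rightarrow> bool" where
  "geodesic_space _ \<longleftrightarrow>
     (\<forall>x y :: 'a. \<exists>\<gamma> :: real \<Rightarrow> 'a. \<gamma> 0 = x \<and> \<gamma> 1 = y \<and>
        (\<forall>s\<in>{0..1}. \<forall>t\<in>{0..1}. dist (\<gamma> s) (\<gamma> t) = \<bar>t - s\<bar> * dist x y))"

text \<open>A function on \<open>[0, \<infinity>)\<close> is represented by a function on the reals of which only the
  values on \<open>{0..}\<close> matter; at 0 the derivative is the one-sided one.\<close>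

definition C1_on_nonneg :: "(real \<Rightarrow> real) \<Rightarrow> bool" where
  "C1_on_nonneg \<alpha> \<longleftrightarrow>
     (\<exists>\<alpha>'. continuous_on {0..} \<alpha>' \<and>
        (\<forall>h\<ge>0. (\<alpha> has_real_derivative \<alpha>' h) (at h within {0..})))"

text \<open>The supremum may be infinite (take \<open>\<alpha>\<close> linear), so the conjugate is extended-real-valued.
  Its argument is extended real because the slopes below are limits superior in \<^typ>\<open>ereal\<close>;
  at \<open>u = \<infinity>\<close> the value is \<open>\<infinity>\<close> (the term at \<open>h = 1\<close>).\<close>

definition conjugate :: "(real \<Rightarrow> real) \<Rightarrow> ereal \<Rightarrow> ereal" where
  "conjugate \<alpha> u = (SUP h\<in>{0..}. ereal h * u - ereal (\<alpha> h))"

text \<open>The convention at isolated points has to be imposed explicitly: there \<open>at x\<close> is the trivial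
  filter, along which \<^const>\<open>Limsup\<close> is \<open>-\<infinity>\<close>.\<close>

definition slope_plus :: "('a::metric_space \<Rightarrow> real) \<Rightarrow> 'a \<Rightarrow> ereal" where
  "slope_plus g x =
     (if x isolated_in UNIV then 0
      else Limsup (at x) (\<lambda>y. ereal (max 0 (g y - g x) / dist x y)))"

definition slope_minus :: "('a::metric_space \<Rightarrow> real) \<Rightarrow> 'a \<Rightarrow> ereal" where
  "slope_minus g x =
     (if x isolated_in UNIV then 0
      else Limsup (at x) (\<lambda>y. ereal (max 0 (- (g y - g x)) / dist x y)))"

text \<open>A supremum in the reals: meaningful for \<open>t > 0\<close>, nonnegative \<open>\<alpha>\<close> and \<open>f\<close> bounded above.\<close>

definition sup_conv ::
    "(real \<Rightarrow> real) \<Rightarrow> ('a::metric_space \<Rightarrow> real) \<Rightarrow> real \<Rightarrow> 'a \<Rightarrow> real" where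
  "sup_conv \<alpha> f t x = (SUP y. f y - t * \<alpha> (dist x y / t))"

end

theory Submission
  imports Defs
begin

text \<open>For \<open>\<alpha>\<close> not identically zero the supremum defining \<open>P\<^sub>t f(x)\<close> is attained, on a compact
  set of maximisers.  Let \<open>D\<^sup>+\<close> and \<open>D\<^sup>-\<close> be their largest and smallest distances to \<open>x\<close>, and put
  \<open>\<beta>(h) = h \<alpha>'(h) - \<alpha>(h) = \<alpha>\<^sup>*(\<alpha>'(h))\<close>.  Maximisers for data near \<open>(t, x)\<close> accumulate only at
  maximisers for \<open>(t, x)\<close>, so a comparison of competitors yields the one-sided time derivatives
  \<open>\<beta>(D\<^sup>+/t)\<close> and \<open>\<beta>(D\<^sup>-/t)\<close>, and the bounds \<open>\<alpha>'(D\<^sup>+/t)\<close> and \<open>\<alpha>'(D\<^sup>-/t)\<close> for the slopes.  In a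
  geodesic space, moving from \<open>x\<close> towards a farthest maximiser shows that the first slope
  bound is an equality.\<close>

section \<open>Conjugate and isolated points\<close>

lemma conjugate_mono:
  assumes "u \<le> v"
  shows "conjugate \<alpha> u \<le> conjugate \<alpha> v"
  unfolding conjugate_def
proof (rule SUP_mono)
  fix h :: real assume h: "h \<in> {0..}"
  then have "ereal h * u - ereal (\<alpha> h) \<le> ereal h * v - ereal (\<alpha> h)"
    by (intro ereal_minus_mono ereal_mult_left_mono assms) auto
  with h show "\<exists>k\<in>{0..}. ereal h * u - ereal (\<alpha> h) \<le> ereal k * v - ereal (\<alpha> k)" ..
qed

text \<open>The term at \<open>h = 0\<close> suffices: \<open>0 * \<infinity> = 0\<close> in
  \<open>ereal\<close>, so it vanishes for an infinite \<open>u\<close> as well.\<close>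

lemma conjugate_nonneg:
  assumes "\<alpha> 0 = 0"
  shows "0 \<le> conjugate \<alpha> u"
  unfolding conjugate_def by (rule SUP_upper2[of 0]) (auto simp: assms zero_ereal_def[symmetric])

lemma isolated_in_UNIV_iff: "x isolated_in UNIV \<longleftrightarrow> at x = bot"
  using isolated_in_islimpt_iff[of x UNIV] by (simp add: trivial_limit_within)

text \<open>The zero cost is excluded because \<open>P t x\<close> is then the supremum of
  \<open>f\<close>, which need not be attained. Any other admissible cost grows at least linearly,
  by convexity, and this confines near-maximisers to a ball.\<close>

locale sup_conv_data =
  fixes \<alpha> \<alpha>' :: "real \<Rightarrow> real" and f :: "'a::metric_space \<Rightarrow> real"
  assumes proper: "\<And>(x::'a) r. compact (cball x r)"
    and alpha_mono: "mono_on {0..} \<alpha>"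
    and alpha_convex: "convex_on {0..} \<alpha>"
    and alpha_0: "\<alpha> 0 = 0"
    and alpha'_cont: "continuous_on {0..} \<alpha>'"
    and alpha_deriv: "\<And>h. 0 \<le> h \<Longrightarrow> (\<alpha> has_real_derivative \<alpha>' h) (at h within {0..})"
    and alpha_nontrivial: "\<exists>h\<ge>0. \<alpha> h \<noteq> 0"
    and f_usc: "upper_semicontinuous f"
    and f_bdd: "bdd_above (range f)"
begin

definition \<beta> :: "real \<Rightarrow> real" where
  "\<beta> h = h * \<alpha>' h - \<alpha> h"

definition val :: "real \<Rightarrow> 'a \<Rightarrow> 'a \<Rightarrow> real" where
  "val t x y = f y - t * \<alpha> (dist x y / t)"

definition maximisers :: "real \<Rightarrow> 'a \<Rightarrow> 'a set" where
  "maximisers t x = {z. \<forall>w. val t x w \<le> val t x z}"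

abbreviation P :: "real \<Rightarrow> 'a \<Rightarrow> real" where
  "P \<equiv> sup_conv \<alpha> f"

section \<open>Convex analysis of the cost\<close>

lemma alpha_nonneg: "0 \<le> h \<Longrightarrow> 0 \<le> \<alpha> h"
  using mono_onD[OF alpha_mono, of 0 h] alpha_0 by simp

lemma alpha_cont: "continuous_on {0..} \<alpha>"
  using alpha_deriv by (auto intro: DERIV_continuous_on)

lemma tendsto_alpha:
  assumes "(g \<longlongrightarrow> l) F" "0 \<le> l" "\<forall>\<^sub>F n in F. 0 \<le> g n"
  shows "((\<lambda>n. \<alpha> (g n)) \<longlongrightarrow> \<alpha> l) F"
  by (rule continuous_on_tendsto_compose[OF alpha_cont assms(1)]) (use assms in auto)

lemma tendsto_alpha':
  assumes "(g \<longlongrightarrow> l) F" "0 \<le> l" "\<forall>\<^sub>F n in F. 0 \<le> g n"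
  shows "((\<lambda>n. \<alpha>' (g n)) \<longlongrightarrow> \<alpha>' l) F"
  by (rule continuous_on_tendsto_compose[OF alpha'_cont assms(1)]) (use assms in auto)

lemma tendsto_beta:
  assumes "(g \<longlongrightarrow> l) F" "0 \<le> l" "\<forall>\<^sub>F n in F. 0 \<le> g n"
  shows "((\<lambda>n. \<beta> (g n)) \<longlongrightarrow> \<beta> l) F"
  unfolding \<beta>_def by (intro tendsto_intros tendsto_alpha tendsto_alpha' assms)

lemma tangent_le:
  assumes "0 \<le> a" "0 \<le> b"
  shows "\<alpha> a + \<alpha>' a * (b - a) \<le> \<alpha> b"
proof -
  have *: "\<alpha> c + \<alpha>' c * (b - c) \<le> \<alpha> b" if "c > 0" for c
    using convex_on_imp_above_tangent[OF alpha_convex, of c b "\<alpha>' c"] alpha_deriv[of c] that assms(2)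
    by (simp add: algebra_simps)
  have t: "((\<lambda>c. c) \<longlongrightarrow> a) (at_right a)"
    by (rule tendsto_ident_at)
  have ev: "\<forall>\<^sub>F c in at_right a. 0 < c"
    using assms(1) by (intro eventually_at_rightI[of a "a + 1"]) auto
  have ev': "\<forall>\<^sub>F c in at_right a. 0 \<le> c"
    using ev by eventually_elim simp
  \<comment> \<open>The supporting line is available at interior points \<open>c > 0\<close>;
    letting \<open>c\<close> decrease to \<open>a\<close> also covers the endpoint
    \<open>a = 0\<close>.\<close>
  have "((\<lambda>c. \<alpha> c + \<alpha>' c * (b - c)) \<longlongrightarrow> \<alpha> a + \<alpha>' a * (b - a)) (at_right a)"
    by (intro tendsto_intros tendsto_alpha tendsto_alpha' t assms ev')
  then show ?thesis
    by (rule tendsto_upperbound) (use ev * in \<open>auto elim: eventually_mono\<close>)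
qed

lemma alpha'_mono:
  assumes "0 \<le> a" "a \<le> b"
  shows "\<alpha>' a \<le> \<alpha>' b"
proof (cases "a = b")
  case False
  have "\<alpha>' a * (b - a) \<le> \<alpha>' b * (b - a)"
    using tangent_le[of a b] tangent_le[of b a] assms by (simp add: algebra_simps)
  then show ?thesis using False assms by simp
qed simp

lemma alpha'_nonneg:
  assumes "0 \<le> a"
  shows "0 \<le> \<alpha>' a"
proof -
  have "0 \<le> \<alpha>' c" if "c > 0" for c
  proof -
    have "0 \<le> \<alpha>' c * c"
      using tangent_le[of c 0] alpha_nonneg[of c] that alpha_0 by simp
    then show ?thesis using that by (simp add: zero_le_mult_iff)
  qed
  then have ev: "\<forall>\<^sub>F c in at_right (0::real). 0 \<le> \<alpha>' c"
    by (intro eventually_at_rightI[of 0 1]) auto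
  have "((\<lambda>c. \<alpha>' c) \<longlongrightarrow> \<alpha>' 0) (at_right 0)"
    by (rule tendsto_alpha') (auto intro: tendsto_ident_at eventually_at_rightI[of 0 1])
  then have "0 \<le> \<alpha>' 0"
    by (rule tendsto_lowerbound[OF _ ev]) simp
  then show ?thesis using alpha'_mono[of 0 a] assms by simp
qed

text \<open>The tangent at \<open>b\<close>, evaluated at \<open>a\<close>, gives
  \<open>\<beta> b \<ge> a * \<alpha>' b - \<alpha> a\<close>, and \<open>\<alpha>'\<close> is
  increasing.\<close>

lemma beta_mono:
  assumes "0 \<le> a" "a \<le> b"
  shows "\<beta> a \<le> \<beta> b"
proof -
  have "0 \<le> a * (\<alpha>' b - \<alpha>' a)"
    using alpha'_mono assms by simp
  then show ?thesis
    using tangent_le[of b a] assms by (simp add: \<beta>_def algebra_simps)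
qed

text \<open>Equality case of Fenchel-Young: by the tangent inequality at \<open>h\<close>, the
  supremum over \<open>k\<close> is attained at \<open>k = h\<close>.\<close>

lemma conjugate_alpha':
  assumes "0 \<le> h"
  shows "conjugate \<alpha> (ereal (\<alpha>' h)) = ereal (\<beta> h)"
  unfolding conjugate_def
proof (rule SUP_eqI)
  show "ereal k * ereal (\<alpha>' h) - ereal (\<alpha> k) \<le> ereal (\<beta> h)" if "k \<in> {0..}" for k
    using tangent_le[of h k] assms that by (simp add: \<beta>_def algebra_simps)
  show "ereal (\<beta> h) \<le> y"
    if "\<And>k. k \<in> {0..} \<Longrightarrow> ereal k * ereal (\<alpha>' h) - ereal (\<alpha> k) \<le> y" for y
    using that[of h] assms by (simp add: \<beta>_def)
qed

text \<open>For fixed \<open>d\<close> the perspective \<open>t * \<alpha> (d / t)\<close> is convex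
  in \<open>t\<close> with derivative \<open>- \<beta> (d / t)\<close>. This is its tangent
  inequality at \<open>t\<close>, valid for either sign of \<open>s - t\<close>.\<close>

lemma cost_time_diff:
  assumes "s > 0" "t > 0" "d \<ge> 0"
  shows "t * \<alpha> (d / t) - s * \<alpha> (d / s) \<le> (s - t) * \<beta> (d / t)"
proof -
  have "s * (\<alpha> (d/t) + \<alpha>' (d/t) * (d/s - d/t)) \<le> s * \<alpha> (d/s)"
    using tangent_le[of "d/t" "d/s"] assms by (intro mult_left_mono) auto
  moreover have "s * (\<alpha> (d/t) + \<alpha>' (d/t) * (d/s - d/t))
      = s * \<alpha> (d/t) - (s - t) * ((d/t) * \<alpha>' (d/t))"
    using assms by (simp add: field_simps)
  ultimately show ?thesis
    unfolding \<beta>_def by (simp add: algebra_simps)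
qed

text \<open>Tangent inequality at \<open>dist x z / t\<close>, followed by the triangle inequality,
  which may be applied under the factor \<open>\<alpha>'\<close> because that factor is
  nonnegative.\<close>

lemma cost_space_diff:
  assumes "t > 0"
  shows "t * \<alpha> (dist x z / t) - t * \<alpha> (dist y z / t) \<le> dist x y * \<alpha>' (dist x z / t)"
proof -
  have "t * (\<alpha> (dist x z / t) - \<alpha> (dist y z / t))
      \<le> t * (\<alpha>' (dist x z / t) * (dist x z / t - dist y z / t))"
    using tangent_le[of "dist x z / t" "dist y z / t"] assms
    by (intro mult_left_mono) (auto simp: algebra_simps)
  also have "\<dots> = \<alpha>' (dist x z / t) * (dist x z - dist y z)"
    using assms by (simp add: field_simps)
  also have "\<dots> \<le> \<alpha>' (dist x z / t) * dist x y"
    using assms dist_triangle[of x z y] by (intro mult_left_mono alpha'_nonneg) auto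
  finally show ?thesis by (simp add: algebra_simps)
qed

text \<open>The tangent at a point \<open>h0\<close> with \<open>\<alpha> h0 > 0\<close> is the
  required line. Its slope is positive because, evaluated at 0, it must lie below
  \<open>\<alpha> 0 = 0\<close>.\<close>

lemma coercive:
  obtains c k where "c > 0" "k \<ge> 0" "\<And>h. 0 \<le> h \<Longrightarrow> c * h - k \<le> \<alpha> h"
proof -
  obtain h0 where h0: "h0 \<ge> 0" "\<alpha> h0 \<noteq> 0" using alpha_nontrivial by auto
  have pos: "\<alpha> h0 > 0" using h0 alpha_nonneg[of h0] by simp
  have "\<alpha>' h0 * h0 > 0"
    using tangent_le[of h0 0] h0 pos alpha_0 by simp
  then have "\<alpha>' h0 > 0" using alpha'_nonneg[of h0] h0
    by (simp add: zero_less_mult_iff)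
  then show ?thesis
    using that[of "\<alpha>' h0" "\<alpha>' h0 * h0"] tangent_le[of h0] h0 pos
    by (fastforce simp: algebra_simps)
qed

section \<open>Compactness of near-maximisers\<close>

lemma tendsto_cost:
  assumes "(s \<longlongrightarrow> t) F" "t > 0" "(y \<longlongrightarrow> x) F" "(z \<longlongrightarrow> w) F"
  shows "((\<lambda>n. s n * \<alpha> (dist (y n) (z n) / s n)) \<longlongrightarrow> t * \<alpha> (dist x w / t)) F"
proof -
  have "\<forall>\<^sub>F n in F. 0 < s n"
    using assms(1,2) by (rule order_tendstoD)
  then have "\<forall>\<^sub>F n in F. 0 \<le> dist (y n) (z n) / s n"
    by eventually_elim simp
  then show ?thesis
    using assms(2) by (intro tendsto_intros tendsto_alpha assms) auto
qed

text \<open>Comparing \<open>z n\<close> with the competitor \<open>x\<close> bounds the cost paid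
  by \<open>z n\<close>, and coercivity turns this into a bound on its distance.\<close>

lemma near_maximisers_bounded:
  assumes s: "s \<longlonglongrightarrow> t" and t: "t > 0" and y: "y \<longlonglongrightarrow> x" and e: "e \<longlonglongrightarrow> 0"
    and max: "\<And>n w. val (s n) (y n) w \<le> val (s n) (y n) (z n) + e n"
  shows "\<exists>R. \<forall>\<^sub>F n in sequentially. z n \<in> cball x R"
proof -
  obtain c k where c: "c > 0" "k \<ge> 0" "\<And>h. 0 \<le> h \<Longrightarrow> c * h - k \<le> \<alpha> h"
    using coercive by blast
  obtain M where M: "\<And>w. f w \<le> M"
    using f_bdd by (auto simp: bdd_above_def)
  have "(\<lambda>n. s n * \<alpha> (dist (y n) x / s n)) \<longlonglongrightarrow> t * \<alpha> (dist x x / t)"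
    by (rule tendsto_cost[OF s t y]) simp
  then have ev1: "\<forall>\<^sub>F n in sequentially. s n * \<alpha> (dist (y n) x / s n) < 1"
    by (rule order_tendstoD) (simp add: alpha_0)
  have ev2: "\<forall>\<^sub>F n in sequentially. e n < 1"
    using e by (rule order_tendstoD) simp
  have ev3: "\<forall>\<^sub>F n in sequentially. 0 < s n"
    using s t by (rule order_tendstoD)
  have ev4: "\<forall>\<^sub>F n in sequentially. s n < 2 * t"
    using s by (rule order_tendstoD) (use t in simp)
  have ev5: "\<forall>\<^sub>F n in sequentially. dist (y n) x < 1"
    using y by (rule tendstoD) simp
  \<comment> \<open>The cost of \<open>z n\<close> is at most \<open>M - f x + 2\<close>, with one
    unit for the cost of the competitor \<open>x\<close> and one for \<open>e n\<close>. The term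
    \<open>2 * t * k\<close> bounds \<open>s n * k\<close>, and the leading 1 bounds
    \<open>dist (y n) x\<close>.\<close>
  have "\<forall>\<^sub>F n in sequentially. z n \<in> cball x (1 + (M - f x + 2 + 2 * t * k) / c)"
    using ev1 ev2 ev3 ev4 ev5
  proof eventually_elim
    case (elim n)
    have "s n * (c * (dist (y n) (z n) / s n) - k) \<le> s n * \<alpha> (dist (y n) (z n) / s n)"
      using c(3)[of "dist (y n) (z n) / s n"] elim by (intro mult_left_mono) auto
    moreover have "s n * (c * (dist (y n) (z n) / s n) - k) = c * dist (y n) (z n) - s n * k"
      using elim by (simp add: field_simps)
    moreover have "s n * k \<le> 2 * t * k"
      using elim c by (intro mult_right_mono) auto
    moreover have "s n * \<alpha> (dist (y n) (z n) / s n) \<le> M - f x + 2"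
      using max[of n x] M[of "z n"] elim by (simp add: val_def)
    ultimately have "c * dist (y n) (z n) \<le> M - f x + 2 + 2 * t * k" by linarith
    then have "dist (y n) (z n) \<le> (M - f x + 2 + 2 * t * k) / c"
      using c by (simp add: pos_le_divide_eq mult.commute)
    then show ?case
      using dist_triangle[of x "z n" "y n"] elim by (simp add: dist_commute)
  qed
  then show ?thesis ..
qed

text \<open>The costs converge, while \<open>f (z n)\<close> only has to be bounded above in the
  limit, which is what upper semicontinuity provides.\<close>

lemma near_maximisers_limit:
  assumes s: "s \<longlonglongrightarrow> t" and t: "t > 0" and y: "y \<longlonglongrightarrow> x" and e: "e \<longlonglongrightarrow> 0"
    and max: "\<And>n w. val (s n) (y n) w \<le> val (s n) (y n) (z n) + e n"
    and z: "z \<longlonglongrightarrow> l"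
  shows "l \<in> maximisers t x"
proof -
  have "val t x w \<le> val t x l" for w
  proof (rule field_le_epsilon)
    fix \<epsilon> :: real assume "\<epsilon> > 0"
    have "\<forall>\<^sub>F u in nhds l. f u < f l + \<epsilon>"
      using f_usc \<open>\<epsilon> > 0\<close> by (simp add: upper_semicontinuous_def)
    then have ev: "\<forall>\<^sub>F n in sequentially. f (z n) < f l + \<epsilon>"
      using z by (rule eventually_compose_filterlim)
    have a: "(\<lambda>n. val (s n) (y n) w) \<longlonglongrightarrow> val t x w"
      unfolding val_def by (intro tendsto_diff tendsto_const tendsto_cost s t y)
    have b: "(\<lambda>n. f l + \<epsilon> - s n * \<alpha> (dist (y n) (z n) / s n) + e n)
        \<longlonglongrightarrow> f l + \<epsilon> - t * \<alpha> (dist x l / t) + 0"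
      by (intro tendsto_add tendsto_diff tendsto_const tendsto_cost s t y z e)
    have "val t x w \<le> f l + \<epsilon> - t * \<alpha> (dist x l / t) + 0"
    proof (rule tendsto_le[OF _ b a])
      show "\<forall>\<^sub>F n in sequentially. val (s n) (y n) w
          \<le> f l + \<epsilon> - s n * \<alpha> (dist (y n) (z n) / s n) + e n"
        using ev
      proof eventually_elim
        case (elim n)
        then show ?case using max[of n w] by (simp add: val_def)
      qed
    qed simp
    then show "val t x w \<le> val t x l + \<epsilon>" by (simp add: val_def)
  qed
  then show ?thesis by (simp add: maximisers_def)
qed

text \<open>Common source of three facts: constant data with \<open>e\<close> tending to 0 gives
  existence of maximisers, constant data with \<open>e = 0\<close> gives compactness of their set,
  and moving data with \<open>e = 0\<close> gives stability.\<close>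

lemma near_maximisers_subseq:
  assumes s: "s \<longlonglongrightarrow> t" and t: "t > 0" and y: "y \<longlonglongrightarrow> x" and e: "e \<longlonglongrightarrow> 0"
    and max: "\<And>n w. val (s n) (y n) w \<le> val (s n) (y n) (z n) + e n"
  shows "\<exists>l r. l \<in> maximisers t x \<and> strict_mono r \<and> (z \<circ> r) \<longlonglongrightarrow> l"
proof -
  obtain R N where N: "\<And>n. n \<ge> N \<Longrightarrow> z n \<in> cball x R"
    using near_maximisers_bounded[OF assms] by (auto simp: eventually_sequentially)
  \<comment> \<open>The bound holds only from \<open>N\<close> on, so the subsequence is extracted
    from the shifted sequence.\<close>
  have "\<forall>n. z (n + N) \<in> cball x R" using N by simp
  then obtain l r where r: "strict_mono r" "((\<lambda>n. z (n + N)) \<circ> r) \<longlonglongrightarrow> l"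
    using proper[of x R] unfolding compact_def by metis
  define q where "q n = r n + N" for n
  have q: "strict_mono q" using r(1) by (simp add: q_def strict_mono_def)
  have zq: "(z \<circ> q) \<longlonglongrightarrow> l" using r(2) by (simp add: q_def o_def)
  have "l \<in> maximisers t x"
    by (rule near_maximisers_limit[OF LIMSEQ_subseq_LIMSEQ[OF s q] t
          LIMSEQ_subseq_LIMSEQ[OF y q] LIMSEQ_subseq_LIMSEQ[OF e q] _ zq]) (simp add: max)
  with q zq show ?thesis by blast
qed

lemma bdd_above_val:
  assumes "t > 0"
  shows "bdd_above (range (val t x))"
proof -
  obtain M where M: "\<And>w. f w \<le> M"
    using f_bdd by (auto simp: bdd_above_def)
  have "val t x w \<le> M" for w
    using M[of w] alpha_nonneg[of "dist x w / t"] assms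
    by (smt (verit) val_def divide_nonneg_pos mult_nonneg_nonneg zero_le_dist)
  then show ?thesis by (auto simp: bdd_above_def)
qed

lemma P_eq_val:
  assumes "z \<in> maximisers t x"
  shows "P t x = val t x z"
  unfolding sup_conv_def val_def[symmetric]
  by (rule cSup_eq_maximum) (use assms in \<open>auto simp: maximisers_def\<close>)

lemma maximisers_nonempty:
  assumes "t > 0"
  shows "maximisers t x \<noteq> {}"
proof -
  have "\<exists>z. (SUP w. val t x w) - inverse (real (Suc n)) < val t x z" for n
    using less_cSUP_iff[OF _ bdd_above_val[OF assms], of "(SUP w. val t x w) - inverse (real (Suc n))" x]
    by auto
  then obtain z where z: "\<And>n. (SUP w. val t x w) - inverse (real (Suc n)) < val t x (z n)"
    by metis
  have "val t x w \<le> val t x (z n) + inverse (real (Suc n))" for n w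
    using cSUP_upper[OF UNIV_I bdd_above_val[OF assms], of x w] z[of n] by linarith
  then show ?thesis
    using near_maximisers_subseq[of "\<lambda>_. t" t "\<lambda>_. x" x "\<lambda>n. inverse (real (Suc n))" z]
      assms LIMSEQ_inverse_real_of_nat by auto
qed

lemma val_le_P:
  assumes "t > 0"
  shows "val t x w \<le> P t x"
  using maximisers_nonempty[OF assms, of x] P_eq_val by (fastforce simp: maximisers_def)

lemma compact_maximisers:
  assumes "t > 0"
  shows "compact (maximisers t x)"
  unfolding compact_def
proof (intro allI impI)
  fix z :: "nat \<Rightarrow> 'a" assume "\<forall>n. z n \<in> maximisers t x"
  then show "\<exists>l\<in>maximisers t x. \<exists>r. strict_mono r \<and> (z \<circ> r) \<longlonglongrightarrow> l"
    using near_maximisers_subseq[of "\<lambda>_. t" t "\<lambda>_. x" x "\<lambda>_. 0" z] assms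
    by (auto simp: maximisers_def)
qed

lemma farthest_maximiser:
  assumes "t > 0"
  obtains z where "z \<in> maximisers t x" "\<And>w. w \<in> maximisers t x \<Longrightarrow> dist x w \<le> dist x z"
proof -
  have "continuous_on (maximisers t x) (\<lambda>w. dist x w)"
    by (intro continuous_intros)
  from continuous_attains_sup[OF compact_maximisers[OF assms] maximisers_nonempty[OF assms] this]
  show ?thesis using that by blast
qed

lemma nearest_maximiser:
  assumes "t > 0"
  obtains z where "z \<in> maximisers t x" "\<And>w. w \<in> maximisers t x \<Longrightarrow> dist x z \<le> dist x w"
proof -
  have "continuous_on (maximisers t x) (\<lambda>w. dist x w)"
    by (intro continuous_intros)
  from continuous_attains_inf[OF compact_maximisers[OF assms] maximisers_nonempty[OF assms] this]
  show ?thesis using that by blast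
qed

section \<open>Stability of the maximisers under perturbation of time and base point\<close>

lemma maximisers_upper_hemicontinuous:
  assumes t: "t > 0" and U: "open U" "maximisers t x \<subseteq> U"
  shows "\<forall>\<^sub>F (s, y) in nhds t \<times>\<^sub>F nhds x. maximisers s y \<subseteq> U"
proof (rule ccontr)
  assume not: "\<not> ?thesis"
  \<comment> \<open>Failure yields data converging to \<open>(t, x)\<close> with maximisers outside
    \<open>U\<close>. A subsequence of these converges to a maximiser for \<open>(t, x)\<close>,
    which lies in the open set \<open>U\<close>, a contradiction.\<close>
  have "\<exists>s y z. dist s t < inverse (real (Suc n)) \<and> dist y x < inverse (real (Suc n))
      \<and> z \<in> maximisers s y \<and> z \<notin> U" for n
  proof (rule ccontr)
    assume no: "\<not> ?thesis"
    have "\<forall>\<^sub>F s in nhds t. dist s t < inverse (real (Suc n))"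
      "\<forall>\<^sub>F y in nhds x. dist y x < inverse (real (Suc n))"
      by (auto simp: eventually_nhds_metric intro!: exI[of _ "inverse (real (Suc n))"])
    then have "\<forall>\<^sub>F p in nhds t \<times>\<^sub>F nhds x. case p of (s, y) \<Rightarrow> maximisers s y \<subseteq> U"
      unfolding eventually_prod_filter using no
      by (intro exI[of _ "\<lambda>s. dist s t < inverse (real (Suc n))"]
          exI[of _ "\<lambda>y. dist y x < inverse (real (Suc n))"]) auto
    with not show False by simp
  qed
  then obtain s y z where *: "\<And>n. dist (s n) t < inverse (real (Suc n))"
    "\<And>n. dist (y n) x < inverse (real (Suc n))" "\<And>n. z n \<in> maximisers (s n) (y n)" "\<And>n. z n \<notin> U"
    by metis
  have s: "s \<longlonglongrightarrow> t" and y: "y \<longlonglongrightarrow> x"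
    using *(1,2) by (auto intro!: metric_tendsto_imp_tendsto[OF LIMSEQ_inverse_real_of_nat]
        always_eventually less_imp_le)
  obtain l r where l: "l \<in> maximisers t x" "(z \<circ> r) \<longlonglongrightarrow> l"
    using near_maximisers_subseq[OF s t y tendsto_const, of z] *(3) by (auto simp: maximisers_def)
  have "\<forall>\<^sub>F n in sequentially. (z \<circ> r) n \<in> U"
    using topological_tendstoD[OF l(2) U(1)] l(1) U(2) by blast
  then show False using *(4) by simp
qed

text \<open>The distances \<open>dist x (z n)\<close> themselves need not converge. Truncating from
  below by \<open>D\<close> makes the lower bound trivial, and hemicontinuity with the open set
  \<open>ball x a\<close> gives the upper one.\<close>

lemma tendsto_max_dist:
  assumes t: "t > 0" and s: "(s \<longlongrightarrow> t) F" and y: "(y \<longlongrightarrow> x) F"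
    and z: "\<forall>\<^sub>F n in F. z n \<in> maximisers (s n) (y n)"
    and D: "\<And>w. w \<in> maximisers t x \<Longrightarrow> dist x w \<le> D"
  shows "((\<lambda>n. max D (dist x (z n))) \<longlongrightarrow> D) F"
proof (rule order_tendstoI)
  fix a assume "D < a"
  have "\<forall>\<^sub>F (s, y) in nhds t \<times>\<^sub>F nhds x. maximisers s y \<subseteq> ball x a"
    by (intro maximisers_upper_hemicontinuous t) (use D \<open>D < a\<close> in fastforce)+
  then have "\<forall>\<^sub>F n in F. case (s n, y n) of (s, y) \<Rightarrow> maximisers s y \<subseteq> ball x a"
    by (rule eventually_compose_filterlim[OF _ filterlim_Pair[OF s y]])
  then show "\<forall>\<^sub>F n in F. max D (dist x (z n)) < a"
    using z by eventually_elim (use \<open>D < a\<close> in auto)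
qed (auto intro!: always_eventually)

text \<open>Mirror image of \<open>tendsto_max_dist\<close>, with the complement of a closed ball as
  the open set.\<close>

lemma tendsto_min_dist:
  assumes t: "t > 0" and s: "(s \<longlongrightarrow> t) F" and y: "(y \<longlongrightarrow> x) F"
    and z: "\<forall>\<^sub>F n in F. z n \<in> maximisers (s n) (y n)"
    and D: "\<And>w. w \<in> maximisers t x \<Longrightarrow> D \<le> dist x w"
  shows "((\<lambda>n. min D (dist x (z n))) \<longlongrightarrow> D) F"
proof (rule order_tendstoI)
  fix a assume "a < D"
  have "\<forall>\<^sub>F (s, y) in nhds t \<times>\<^sub>F nhds x. maximisers s y \<subseteq> - cball x a"
    using D \<open>a < D\<close> by (intro maximisers_upper_hemicontinuous t) fastforce+
  then have "\<forall>\<^sub>F n in F. case (s n, y n) of (s, y) \<Rightarrow> maximisers s y \<subseteq> - cball x a"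
    by (rule eventually_compose_filterlim[OF _ filterlim_Pair[OF s y]])
  then show "\<forall>\<^sub>F n in F. a < min D (dist x (z n))"
    using z by eventually_elim (use \<open>a < D\<close> in auto)
qed (auto intro!: always_eventually)

section \<open>Comparison of competitors and one-sided time derivatives\<close>

lemma P_time_diff_le:
  assumes "s > 0" "t > 0" "z \<in> maximisers s x"
  shows "P s x - P t x \<le> (s - t) * \<beta> (dist x z / t)"
  using P_eq_val[OF assms(3)] val_le_P[OF assms(2), of x z] cost_time_diff[OF assms(1,2), of "dist x z"]
  by (simp add: val_def)

text \<open>As in the time comparison, a maximiser for one problem is used as competitor in the
  other. The distance on the right is measured from \<open>x\<close>, where \<open>z\<close> is
  merely a competitor.\<close>

lemma P_space_diff_le:
  assumes "t > 0" "z \<in> maximisers t y"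
  shows "P t y - P t x \<le> dist x y * \<alpha>' (dist x z / t)"
  using P_eq_val[OF assms(2)] val_le_P[OF assms(1), of x z] cost_space_diff[OF assms(1), of x z y]
  by (simp add: val_def)

text \<open>Both bounds come from \<open>P_time_diff_le\<close> with the roles of the two times
  exchanged: \<open>z\<close> as competitor at the later time \<open>s\<close> gives the lower
  bound, a maximiser \<open>Z s\<close> as competitor at \<open>t\<close> the upper one. Since
  \<open>Z s\<close> is asymptotically no farther than \<open>z\<close>, the bounds meet.\<close>

lemma right_derivative_P:
  assumes t: "t > 0" and z: "z \<in> maximisers t x"
    and far: "\<And>w. w \<in> maximisers t x \<Longrightarrow> dist x w \<le> dist x z"
  shows "((\<lambda>s. P s x) has_real_derivative \<beta> (dist x z / t)) (at_right t)"
  unfolding has_field_derivative_iff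
proof (rule tendsto_sandwich)
  define Z where "Z s = (SOME w. w \<in> maximisers s x)" for s
  have Z: "Z s \<in> maximisers s x" if "s > 0" for s
    unfolding Z_def using maximisers_nonempty[OF that] by (simp add: some_in_eq)
  have ev: "\<forall>\<^sub>F s in at_right t. s > t"
    by (rule eventually_at_right_less)
  have id: "((\<lambda>s. s) \<longlongrightarrow> t) (at_right t)"
    by (rule tendsto_ident_at)
  show "\<forall>\<^sub>F s in at_right t. \<beta> (dist x z / s) \<le> (P s x - P t x) / (s - t)"
    using ev
  proof eventually_elim
    case (elim s)
    then show ?case
      using P_time_diff_le[OF t, of s z x] z t by (simp add: field_simps)
  qed
  show "\<forall>\<^sub>F s in at_right t. (P s x - P t x) / (s - t) \<le> \<beta> (max (dist x z) (dist x (Z s)) / t)"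
    using ev
  proof eventually_elim
    case (elim s)
    have "(P s x - P t x) / (s - t) \<le> \<beta> (dist x (Z s) / t)"
      using P_time_diff_le[OF _ t Z, of s] elim t by (simp add: field_simps)
    also have "\<dots> \<le> \<beta> (max (dist x z) (dist x (Z s)) / t)"
      using t by (intro beta_mono divide_right_mono) auto
    finally show ?case .
  qed
  show "((\<lambda>s. \<beta> (dist x z / s)) \<longlongrightarrow> \<beta> (dist x z / t)) (at_right t)"
    using t by (intro tendsto_beta tendsto_intros id eventually_mono[OF ev]) auto
  have "\<forall>\<^sub>F s in at_right t. Z s \<in> maximisers s x"
    using ev by eventually_elim (use t Z in auto)
  from tendsto_max_dist[OF t id tendsto_const this far]
  show "((\<lambda>s. \<beta> (max (dist x z) (dist x (Z s)) / t)) \<longlongrightarrow> \<beta> (dist x z / t)) (at_right t)"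
    using t by (intro tendsto_beta tendsto_intros) (auto intro!: always_eventually simp: le_max_iff_disj)
qed

text \<open>Dividing by the negative number \<open>s - t\<close> reverses both comparisons, so the
  nearest maximiser replaces the farthest one.\<close>

lemma left_derivative_P:
  assumes t: "t > 0" and z: "z \<in> maximisers t x"
    and near: "\<And>w. w \<in> maximisers t x \<Longrightarrow> dist x z \<le> dist x w"
  shows "((\<lambda>s. P s x) has_real_derivative \<beta> (dist x z / t)) (at_left t)"
  unfolding has_field_derivative_iff
proof (rule tendsto_sandwich)
  define Z where "Z s = (SOME w. w \<in> maximisers s x)" for s
  have Z: "Z s \<in> maximisers s x" if "s > 0" for s
    unfolding Z_def using maximisers_nonempty[OF that] by (simp add: some_in_eq)
  have ev: "\<forall>\<^sub>F s in at_left t. 0 < s \<and> s < t"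
    using t by (intro eventually_at_leftI[of 0]) auto
  have id: "((\<lambda>s. s) \<longlongrightarrow> t) (at_left t)"
    by (rule tendsto_ident_at)
  show "\<forall>\<^sub>F s in at_left t. (P s x - P t x) / (s - t) \<le> \<beta> (dist x z / s)"
    using ev
  proof eventually_elim
    case (elim s)
    then show ?case
      using P_time_diff_le[OF t, of s z x] z t by (simp add: field_simps)
  qed
  show "\<forall>\<^sub>F s in at_left t. \<beta> (min (dist x z) (dist x (Z s)) / t) \<le> (P s x - P t x) / (s - t)"
    using ev
  proof eventually_elim
    case (elim s)
    have "\<beta> (min (dist x z) (dist x (Z s)) / t) \<le> \<beta> (dist x (Z s) / t)"
      using t by (intro beta_mono divide_right_mono) auto
    also have "\<dots> \<le> (P s x - P t x) / (s - t)"
      using P_time_diff_le[OF _ t Z, of s] elim t by (simp add: field_simps)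
    finally show ?case .
  qed
  show "((\<lambda>s. \<beta> (dist x z / s)) \<longlongrightarrow> \<beta> (dist x z / t)) (at_left t)"
    using t by (intro tendsto_beta tendsto_intros id eventually_mono[OF ev]) auto
  have "\<forall>\<^sub>F s in at_left t. Z s \<in> maximisers s x"
    using ev by eventually_elim (use Z in auto)
  from tendsto_min_dist[OF t id tendsto_const this near]
  show "((\<lambda>s. \<beta> (min (dist x z) (dist x (Z s)) / t)) \<longlongrightarrow> \<beta> (dist x z / t)) (at_left t)"
    using t by (intro tendsto_beta tendsto_intros) (auto intro!: always_eventually)
qed

section \<open>Bounds for the slopes\<close>

lemma slope_plus_le:
  assumes t: "t > 0" and far: "\<And>w. w \<in> maximisers t x \<Longrightarrow> dist x w \<le> D" and D: "D \<ge> 0"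
  shows "slope_plus (P t) x \<le> ereal (\<alpha>' (D / t))"
proof (cases "at x = bot")
  \<comment> \<open>At an isolated point the slope is 0 by convention, and the bound is
    nonnegative.\<close>
  case True
  then show ?thesis
    using alpha'_nonneg[of "D / t"] D t by (simp add: slope_plus_def isolated_in_UNIV_iff)
next
  case False
  define Z where "Z y = (SOME w. w \<in> maximisers t y)" for y
  have Z: "Z y \<in> maximisers t y" for y
    unfolding Z_def using maximisers_nonempty[OF t] by (simp add: some_in_eq)
  \<comment> \<open>An increase of \<open>P t\<close> towards \<open>y\<close> is controlled by
    maximisers for \<open>y\<close>, so stability as \<open>y\<close> tends to \<open>x\<close> is
    needed.\<close>
  have "((\<lambda>y. max D (dist x (Z y))) \<longlongrightarrow> D) (at x)"
    by (rule tendsto_max_dist[OF t tendsto_const tendsto_ident_at _ far]) (auto simp: Z)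
  then have "((\<lambda>y. \<alpha>' (max D (dist x (Z y)) / t)) \<longlongrightarrow> \<alpha>' (D / t)) (at x)"
    using t D by (intro tendsto_alpha' tendsto_intros) (auto intro!: always_eventually simp: le_max_iff_disj)
  then have L: "Limsup (at x) (\<lambda>y. ereal (\<alpha>' (max D (dist x (Z y)) / t))) = ereal (\<alpha>' (D / t))"
    using False by (intro lim_imp_Limsup tendsto_intros) auto
  have "\<forall>\<^sub>F y in at x. y \<noteq> x"
    by (simp add: eventually_at_filter)
  then have "\<forall>\<^sub>F y in at x. ereal (max 0 (P t y - P t x) / dist x y)
      \<le> ereal (\<alpha>' (max D (dist x (Z y)) / t))"
  proof eventually_elim
    case (elim y)
    have "P t y - P t x \<le> dist x y * \<alpha>' (dist x (Z y) / t)"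
      by (rule P_space_diff_le[OF t Z])
    also have "\<dots> \<le> dist x y * \<alpha>' (max D (dist x (Z y)) / t)"
      using t by (intro mult_left_mono alpha'_mono divide_right_mono) auto
    finally show ?case
      using elim alpha'_nonneg[of "max D (dist x (Z y)) / t"] t D
      by (simp add: field_simps le_max_iff_disj)
  qed
  then have "Limsup (at x) (\<lambda>y. ereal (max 0 (P t y - P t x) / dist x y)) \<le> ereal (\<alpha>' (D / t))"
    unfolding L[symmetric] by (rule Limsup_mono)
  then show ?thesis
    using False by (simp add: slope_plus_def isolated_in_UNIV_iff)
qed

text \<open>For a decrease, the fixed maximiser \<open>z\<close> for \<open>x\<close> serves as
  competitor at every \<open>y\<close>, so continuity of \<open>\<alpha>'\<close> suffices and any
  maximiser is allowed; the nearest one gives the sharpest bound.\<close>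

lemma slope_minus_le:
  assumes t: "t > 0" and z: "z \<in> maximisers t x"
  shows "slope_minus (P t) x \<le> ereal (\<alpha>' (dist x z / t))"
proof (cases "at x = bot")
  case True
  then show ?thesis
    using alpha'_nonneg[of "dist x z / t"] t by (simp add: slope_minus_def isolated_in_UNIV_iff)
next
  case False
  have "((\<lambda>y. dist y z / t) \<longlongrightarrow> dist x z / t) (at x)"
    using t by (intro tendsto_intros) auto
  then have "((\<lambda>y. \<alpha>' (dist y z / t)) \<longlongrightarrow> \<alpha>' (dist x z / t)) (at x)"
    using t by (intro tendsto_alpha') auto
  then have L: "Limsup (at x) (\<lambda>y. ereal (\<alpha>' (dist y z / t))) = ereal (\<alpha>' (dist x z / t))"
    using False by (intro lim_imp_Limsup tendsto_intros) auto
  have "\<forall>\<^sub>F y in at x. y \<noteq> x"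
    by (simp add: eventually_at_filter)
  then have "\<forall>\<^sub>F y in at x. ereal (max 0 (- (P t y - P t x)) / dist x y) \<le> ereal (\<alpha>' (dist y z / t))"
  proof eventually_elim
    case (elim y)
    have "P t x - P t y \<le> dist x y * \<alpha>' (dist y z / t)"
      using P_space_diff_le[OF t z, of y] by (simp add: dist_commute)
    then show ?case
      using elim alpha'_nonneg[of "dist y z / t"] t by (simp add: field_simps)
  qed
  then have "Limsup (at x) (\<lambda>y. ereal (max 0 (- (P t y - P t x)) / dist x y))
      \<le> ereal (\<alpha>' (dist x z / t))"
    unfolding L[symmetric] by (rule Limsup_mono)
  then show ?thesis
    using False by (simp add: slope_minus_def isolated_in_UNIV_iff)
qed

text \<open>Moving a fraction \<open>s\<close> along a geodesic to \<open>z\<close> saves exactly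
  \<open>s * D\<close> of distance. Keeping \<open>z\<close> as competitor bounds the gain in
  \<open>P t\<close> from below by the tangent inequality at \<open>(1 - s) * D / t\<close>.\<close>

lemma slope_plus_ge_geodesic:
  assumes geo: "geodesic_space TYPE('a)" and t: "t > 0" and z: "z \<in> maximisers t x" and "z \<noteq> x"
  shows "ereal (\<alpha>' (dist x z / t)) \<le> slope_plus (P t) x"
proof -
  define D where "D = dist x z"
  have D: "D > 0" using \<open>z \<noteq> x\<close> by (simp add: D_def)
  obtain \<gamma> where \<gamma>: "\<gamma> 0 = x" "\<gamma> 1 = z"
    "\<And>s t. \<lbrakk>s \<in> {0..1}; t \<in> {0..1}\<rbrakk> \<Longrightarrow> dist (\<gamma> s) (\<gamma> t) = \<bar>t - s\<bar> * D"
    using geo unfolding geodesic_space_def D_def by (metis (lifting))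
  have d0: "dist x (\<gamma> s) = s * D" and d1: "dist (\<gamma> s) z = (1 - s) * D" if "s \<in> {0..1}" for s
    using \<gamma>(3)[of 0 s] \<gamma>(3)[of s 1] that by (auto simp: \<gamma>(1,2))
  have ev: "\<forall>\<^sub>F s in at_right 0. s \<in> {0<..<1::real}"
    by (rule eventually_at_rightI[of 0 1]) auto
  have "((\<lambda>s. s * D) \<longlongrightarrow> 0 * D) (at_right 0)"
    by (intro tendsto_intros)
  moreover have "\<forall>\<^sub>F s in at_right 0. s * D = dist (\<gamma> s) x"
    using ev by eventually_elim (use d0 in \<open>auto simp: dist_commute\<close>)
  ultimately have "((\<lambda>s. dist (\<gamma> s) x) \<longlongrightarrow> 0) (at_right 0)"
    by (simp add: tendsto_cong)
  then have "(\<gamma> \<longlongrightarrow> x) (at_right 0)"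
    by (rule tendsto_dist_iff[THEN iffD2])
  moreover have "\<forall>\<^sub>F s in at_right 0. \<gamma> s \<noteq> x"
    using ev
  proof eventually_elim
    case (elim s)
    then show ?case using d0[of s] D by auto
  qed
  ultimately have lim: "filterlim \<gamma> (at x) (at_right 0)"
    by (simp add: filterlim_at)
  \<comment> \<open>The geodesic reaches \<open>x\<close> through other points, so \<open>x\<close>
    is not isolated and its slope is a genuine limsup.\<close>
  then have "at x \<noteq> bot"
    by (auto simp: filterlim_def bot_unique filtermap_bot_iff)
  let ?q = "\<lambda>y. ereal (max 0 (P t y - P t x) / dist x y)"
  have ge: "\<forall>\<^sub>F s in at_right 0. ereal (\<alpha>' ((1 - s) * D / t)) \<le> ?q (\<gamma> s)"
    using ev
  proof eventually_elim
    case (elim s)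
    have "val t (\<gamma> s) z \<le> P t (\<gamma> s)" by (rule val_le_P[OF t])
    moreover have "val t (\<gamma> s) z = f z - t * \<alpha> ((1 - s) * D / t)"
      using d1[of s] elim by (simp add: val_def)
    moreover have "P t x = f z - t * \<alpha> (D / t)"
      using P_eq_val[OF z] by (simp add: val_def D_def)
    ultimately have "t * (\<alpha> (D / t) - \<alpha> ((1 - s) * D / t)) \<le> P t (\<gamma> s) - P t x"
      by (simp add: right_diff_distrib)
    moreover have "t * (\<alpha>' ((1 - s) * D / t) * (D / t - (1 - s) * D / t))
        \<le> t * (\<alpha> (D / t) - \<alpha> ((1 - s) * D / t))"
      using tangent_le[of "(1 - s) * D / t" "D / t"] D t elim by (intro mult_left_mono) auto
    moreover have "t * (\<alpha>' ((1 - s) * D / t) * (D / t - (1 - s) * D / t))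
        = \<alpha>' ((1 - s) * D / t) * (s * D)"
      using t by (simp add: field_simps)
    ultimately have "\<alpha>' ((1 - s) * D / t) * (s * D) \<le> max 0 (P t (\<gamma> s) - P t x)" by linarith
    then show ?case
      using elim D d0[of s] by (simp add: pos_le_divide_eq)
  qed
  have "((\<lambda>s. (1 - s) * D / t) \<longlongrightarrow> (1 - 0) * D / t) (at_right 0)"
    using t by (intro tendsto_intros) auto
  moreover have "\<forall>\<^sub>F s in at_right 0. 0 \<le> (1 - s) * D / t"
    using ev by eventually_elim (use D t in auto)
  ultimately have "((\<lambda>s. \<alpha>' ((1 - s) * D / t)) \<longlongrightarrow> \<alpha>' (D / t)) (at_right 0)"
    using D t by (intro tendsto_alpha') auto
  then have L: "Limsup (at_right 0) (\<lambda>s. ereal (\<alpha>' ((1 - s) * D / t))) = ereal (\<alpha>' (D / t))"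
    by (intro lim_imp_Limsup tendsto_intros) auto
  have "ereal (\<alpha>' (D / t)) \<le> Limsup (at_right 0) (\<lambda>s. ?q (\<gamma> s))"
    unfolding L[symmetric] using ge by (rule Limsup_mono)
  \<comment> \<open>The limsup along one curve ending at \<open>x\<close> is at most the limsup over
    all approaches to \<open>x\<close>.\<close>
  also have "\<dots> \<le> Limsup (filtermap \<gamma> (at_right 0)) ?q"
    by (rule Limsup_filtermap_ge)
  also have "\<dots> \<le> Limsup (at x) ?q"
    using lim unfolding Limsup_def
    by (intro INF_superset_mono) (auto simp: filterlim_def le_filter_def)
  finally show ?thesis
    using \<open>at x \<noteq> bot\<close> by (simp add: slope_plus_def isolated_in_UNIV_iff D_def)
qed

section \<open>Derivatives against conjugates of slopes\<close>

lemma right_derivative_and_slope: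
  assumes t: "t > 0"
  shows "\<exists>D. ((\<lambda>s. P s x) has_real_derivative D) (at_right t) \<and>
      conjugate \<alpha> (slope_plus (P t) x) \<le> ereal D \<and>
      (geodesic_space TYPE('a) \<longrightarrow> ereal D = conjugate \<alpha> (slope_plus (P t) x))"
proof -
  obtain z where z: "z \<in> maximisers t x" "\<And>w. w \<in> maximisers t x \<Longrightarrow> dist x w \<le> dist x z"
    using farthest_maximiser[OF t, of x] by blast
  let ?h = "dist x z / t"
  have h: "?h \<ge> 0" using t by simp
  have le: "conjugate \<alpha> (slope_plus (P t) x) \<le> ereal (\<beta> ?h)"
    unfolding conjugate_alpha'[OF h, symmetric]
    using slope_plus_le[OF t z(2)] by (intro conjugate_mono) auto
  have "ereal (\<beta> ?h) \<le> conjugate \<alpha> (slope_plus (P t) x)" if "geodesic_space TYPE('a)"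
  proof (cases "z = x")
    \<comment> \<open>If the farthest maximiser is \<open>x\<close> itself there is no geodesic to
      follow, but \<open>\<beta> 0 = 0\<close> and the conjugate is nonnegative.\<close>
    case True
    then show ?thesis
      using conjugate_nonneg[of \<alpha>, OF alpha_0] by (simp add: \<beta>_def alpha_0 zero_ereal_def[symmetric])
  next
    case False
    then show ?thesis
      unfolding conjugate_alpha'[OF h, symmetric]
      using slope_plus_ge_geodesic[OF that t z(1)] by (intro conjugate_mono) auto
  qed
  with le right_derivative_P[OF t z] show ?thesis by (auto intro: antisym)
qed

lemma left_derivative_and_slope:
  assumes t: "t > 0"
  shows "\<exists>D. ((\<lambda>s. P s x) has_real_derivative D) (at_left t) \<and>
      conjugate \<alpha> (slope_minus (P t) x) \<le> ereal D"
proof -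
  obtain z where z: "z \<in> maximisers t x" "\<And>w. w \<in> maximisers t x \<Longrightarrow> dist x z \<le> dist x w"
    using nearest_maximiser[OF t, of x] by blast
  have "conjugate \<alpha> (slope_minus (P t) x) \<le> conjugate \<alpha> (ereal (\<alpha>' (dist x z / t)))"
    using slope_minus_le[OF t z(1)] by (rule conjugate_mono)
  then have "conjugate \<alpha> (slope_minus (P t) x) \<le> ereal (\<beta> (dist x z / t))"
    using t by (simp add: conjugate_alpha')
  with left_derivative_P[OF t z] show ?thesis by blast
qed

end

section \<open>The zero cost and the final assembly\<close>

lemma conjugate_zero:
  assumes "\<And>h. 0 \<le> h \<Longrightarrow> \<alpha> h = 0"
  shows "conjugate \<alpha> 0 = 0"
  unfolding conjugate_def by (rule SUP_eqI) (use assms in force)+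

lemma slope_const:
  shows "slope_plus (\<lambda>_. c) x = 0" "slope_minus (\<lambda>_. c) x = 0"
  by (auto simp: slope_plus_def slope_minus_def isolated_in_UNIV_iff zero_ereal_def[symmetric]
      intro!: Limsup_const)

lemma sup_conv_zero_cost:
  assumes "\<And>h. 0 \<le> h \<Longrightarrow> \<alpha> h = 0" and "t > 0"
  shows "sup_conv \<alpha> f t x = (SUP y. f y)"
  using assms by (simp add: sup_conv_def)

theorem theorem1p6:
  fixes \<alpha> :: "real \<Rightarrow> real" and f :: "'a::complete_space \<Rightarrow> real"
  assumes separable: "separable_space (euclidean :: 'a topology)"
    and proper: "\<And>(x::'a) r. compact (cball x r)"
    and alpha_nonneg: "\<And>h. 0 \<le> h \<Longrightarrow> 0 \<le> \<alpha> h"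
    and alpha_mono: "mono_on {0..} \<alpha>"
    and alpha_convex: "convex_on {0..} \<alpha>"
    and alpha_C1: "C1_on_nonneg \<alpha>"
    and alpha_0: "\<alpha> 0 = 0"
    and f_usc: "upper_semicontinuous f"
    and f_bdd: "bdd_above (range f)"
  shows
    "(\<forall>t>0. \<forall>x. \<exists>D. ((\<lambda>s. sup_conv \<alpha> f s x) has_real_derivative D) (at_right t) \<and>
        ereal D \<ge> conjugate \<alpha> (slope_plus (sup_conv \<alpha> f t) x)) \<and>
     (\<forall>t>0. \<forall>x. \<exists>D. ((\<lambda>s. sup_conv \<alpha> f s x) has_real_derivative D) (at_left t) \<and>
        ereal D \<ge> conjugate \<alpha> (slope_minus (sup_conv \<alpha> f t) x)) \<and>
     (geodesic_space TYPE('a) \<longrightarrow>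
       (\<forall>t>0. \<forall>x. \<exists>D. ((\<lambda>s. sup_conv \<alpha> f s x) has_real_derivative D) (at_right t) \<and>
          ereal D = conjugate \<alpha> (slope_plus (sup_conv \<alpha> f t) x)))"
proof (cases "\<exists>h\<ge>0. \<alpha> h \<noteq> 0")
  case True
  obtain \<alpha>' where "continuous_on {0..} \<alpha>'"
    "\<And>h. 0 \<le> h \<Longrightarrow> (\<alpha> has_real_derivative \<alpha>' h) (at h within {0..})"
    using alpha_C1 unfolding C1_on_nonneg_def by blast
  then interpret sup_conv_data \<alpha> \<alpha>' f
    by unfold_locales (use assms True in auto)
  show ?thesis
    using right_derivative_and_slope left_derivative_and_slope by meson
next
  \<comment> \<open>Now \<open>\<alpha>\<close> vanishes on \<open>{0..}\<close>, so for positive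
    times \<open>P\<close> is the constant supremum of \<open>f\<close>; derivatives, slopes and
    conjugates are all 0.\<close>
  case False
  then have zero: "\<And>h. 0 \<le> h \<Longrightarrow> \<alpha> h = 0" by blast
  note const = sup_conv_zero_cost[of \<alpha>, OF zero]
  have deriv: "((\<lambda>s. sup_conv \<alpha> f s x) has_real_derivative 0) (at t within S)" if "t > 0" for t x S
  proof -
    have "((\<lambda>_. SUP y. f y) has_real_derivative 0) (at t)" by simp
    \<comment> \<open>The constant formula is established only for positive times, which form an
      open set around \<open>t\<close>.\<close>
    then have "((\<lambda>s. sup_conv \<alpha> f s x) has_real_derivative 0) (at t)"
      by (rule has_field_derivative_transform_within_open[of _ _ _ "{0<..}"]) (use that in \<open>auto simp: const\<close>)
    then show ?thesis by (rule has_field_derivative_at_within)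
  qed
  have "sup_conv \<alpha> f t = (\<lambda>_. SUP y. f y)" if "t > 0" for t
    using const[OF _ that] by auto
  then have "conjugate \<alpha> (slope_plus (sup_conv \<alpha> f t) x) = 0"
    "conjugate \<alpha> (slope_minus (sup_conv \<alpha> f t) x) = 0" if "t > 0" for t x
    using that conjugate_zero[of \<alpha>, OF zero] by (simp_all add: slope_const)
  with deriv show ?thesis
    by (auto intro!: exI[of _ 0])
qed

end
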